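(* Let $n\ge 2$ and let $D=(D_1,\dots,D_{n-1})$ be a tuple of positive integers. For $M,N\in\mathbb{Z}^{n-1}$, the value of the long Weyl element Kloosterman sum $S_n(M,N;D)$ depends only on the congruence classes of $M_i$ and $N_i$ in $\mathbb{Z}/D_i\mathbb{Z}$, $i=1,\dots,n-1$; that is, if $M,M',N,N'\in\mathbb{Z}^{n-1}$ satisfy $M_i\equiv M'_i$ and $N_i\equiv N'_i\pmod{D_i}$ for all $1\le i\le n-1$, then $S_n(M,N;D)=S_n(M',N';D)$.
   Context: Definition of $S_n(M,N;D)$: $e(z)=e^{2\pi i z}$. $U$ is the group of upper triangular unipotent $n\times n$ matrices. For $N\in\mathbb{Z}^{n-1}$, $\psi_N$ is the character of $U(\mathbb{R})$, trivial on $U(\mathbb{Z})$, given by $\psi_N(u)=e(N_1u_{1,2}+N_2u_{2,3}+\cdots+N_{n-1}u_{n-1,n})$. For $M\in \mathbb{Z}^{n-1}$, $\tilde M=(M_{n-1},\dots,M_1)$. Let $w_0$ be the long Weyl element: the $n\times n$ matrix whose only nonzero entries are on the anti-diagonal, the entry at position $(n-k+1,k)$ being $(-1)^{k-1}$ ($1\le k\le n$). Let $c=\mathrm{Diag}(1/D_{n-1},\,D_{n-1}/D_{n-2},\dots,D_2/D_1,\,D_1)$, $C(c)=U(\mathbb{R})\,c\,w_0\,U(\mathbb{R})\cap SL(n,\mathbb{Z})$ and $X(c)=U(\mathbb{Z})\backslash C(c)/U(\mathbb{Z})$. Each $\gamma\in C(c)$ is uniquely $\gamma=b_1cw_0b_2$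 with $b_1,b_2\in U(\mathbb{R})$; set $\mu(\gamma)=b_1\in U(\mathbb{Z})\backslash U(\mathbb{R})$ and $\mu'(\gamma)=b_2\in U(\mathbb{R})/U(\mathbb{Z})$. Then $$S_n(M,N;D)=\sum_{x\in X(c)}\psi_{\tilde M}(\mu(x))\,\psi_N(\mu'(x)).$$ *)

theory Defs
  imports "Jordan_Normal_Form.Determinant" "HOL-Number_Theory.Cong"
begin

(* Matrices are indexed from 0 as in Jordan_Normal_Form, so the entry u_{i,j} of the
   mathematical literature is u $$ (i - 1, j - 1).  The tuples M, N, D are functions on nat
   whose values at 1, ..., n - 1 are the entries. *)

definition integral_mat :: "real mat \<Rightarrow> bool" where
  "integral_mat A \<longleftrightarrow> elements_mat A \<subseteq> \<int>"

definition U_real :: "nat \<Rightarrow> real mat set" where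
  "U_real n = {u \<in> carrier_mat n n. upper_triangular u \<and> (\<forall>i<n. u $$ (i, i) = 1)}"

definition U_int :: "nat \<Rightarrow> real mat set" where
  "U_int n = {u \<in> U_real n. integral_mat u}"

definition SL_int :: "nat \<Rightarrow> real mat set" where
  "SL_int n = {A \<in> carrier_mat n n. integral_mat A \<and> det A = 1}"

definition e_fun :: "complex \<Rightarrow> complex" where
  "e_fun z = exp (2 * of_real pi * \<i> * z)"

definition psi :: "nat \<Rightarrow> (nat \<Rightarrow> int) \<Rightarrow> real mat \<Rightarrow> complex" where
  "psi n N u = e_fun (\<Sum>i = 1..n - 1. of_int (N i) * of_real (u $$ (i - 1, i)))"

(* The reversed tuple (M_{n-1}, ..., M_1). *)
definition tilde :: "nat \<Rightarrow> (nat \<Rightarrow> int) \<Rightarrow> nat \<Rightarrow> int" where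
  "tilde n M i = M (n - i)"

definition w0 :: "nat \<Rightarrow> real mat" where
  "w0 n = mat n n (\<lambda>(i, j). if i + j = n - 1 then (- 1) ^ j else 0)"

(* Setting D_0 = D_n = 1, the k-th diagonal entry of
   c = Diag(1/D_{n-1}, D_{n-1}/D_{n-2}, ..., D_2/D_1, D_1) is D_{n-k+1}/D_{n-k} for all
   1 \<le> k \<le> n, that is, with i = k - 1 counted from 0, D_{n-i}/D_{n-i-1}. *)
definition D_ext :: "nat \<Rightarrow> (nat \<Rightarrow> nat) \<Rightarrow> nat \<Rightarrow> nat" where
  "D_ext n D k = (if 1 \<le> k \<and> k \<le> n - 1 then D k else 1)"

definition c_mat :: "nat \<Rightarrow> (nat \<Rightarrow> nat) \<Rightarrow> real mat" where
  "c_mat n D = mat_diag n (\<lambda>i. real (D_ext n D (n - i)) / real (D_ext n D (n - i - 1)))"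

definition C_set :: "nat \<Rightarrow> (nat \<Rightarrow> nat) \<Rightarrow> real mat set" where
  "C_set n D = {b1 * c_mat n D * w0 n * b2 | b1 b2. b1 \<in> U_real n \<and> b2 \<in> U_real n} \<inter> SL_int n"

definition dcoset_rel :: "nat \<Rightarrow> (nat \<Rightarrow> nat) \<Rightarrow> (real mat \<times> real mat) set" where
  "dcoset_rel n D = {(\<gamma>, \<gamma>'). \<gamma> \<in> C_set n D \<and> \<gamma>' \<in> C_set n D \<and>
     (\<exists>u\<in>U_int n. \<exists>v\<in>U_int n. \<gamma>' = u * \<gamma> * v)}"

definition X_set :: "nat \<Rightarrow> (nat \<Rightarrow> nat) \<Rightarrow> real mat set set" where
  "X_set n D = C_set n D // dcoset_rel n D"

(* These are the representatives in U(R) of the classes of b_1 in U(Z)\U(R) and of b_2 in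
   U(R)/U(Z); they are unique by
   mu_eq below. *)
definition mu :: "nat \<Rightarrow> (nat \<Rightarrow> nat) \<Rightarrow> real mat \<Rightarrow> real mat" where
  "mu n D \<gamma> = (THE b1. b1 \<in> U_real n \<and> (\<exists>b2\<in>U_real n. \<gamma> = b1 * c_mat n D * w0 n * b2))"

definition mu' :: "nat \<Rightarrow> (nat \<Rightarrow> nat) \<Rightarrow> real mat \<Rightarrow> real mat" where
  "mu' n D \<gamma> = (THE b2. b2 \<in> U_real n \<and> (\<exists>b1\<in>U_real n. \<gamma> = b1 * c_mat n D * w0 n * b2))"

(* The image of the double coset x under either map is a singleton
   (image_psi_mu_mu' below) and the_elem takes the common value.  X(c) is finite. *)
definition kloosterman ::
  "nat \<Rightarrow> (nat \<Rightarrow> int) \<Rightarrow> (nat \<Rightarrow> int) \<Rightarrow> (nat \<Rightarrow> nat) \<Rightarrow> complex" where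
  "kloosterman n M N D =
     (\<Sum>x\<in>X_set n D. the_elem ((\<lambda>\<gamma>. psi n (tilde n M) (mu n D \<gamma>)) ` x) *
                 the_elem ((\<lambda>\<gamma>. psi n N (mu' n D \<gamma>)) ` x))"

lemma mult_entry:
  fixes A B :: "real mat"
  assumes "A \<in> carrier_mat n n" "B \<in> carrier_mat n n" "i < n" "j < n"
  shows "(A * B) $$ (i, j) = (\<Sum>k<n. A $$ (i, k) * B $$ (k, j))"
  using assms by (auto simp: scalar_prod_def lessThan_atLeast0)

lemma integral_mat_iff:
  "A \<in> carrier_mat n n \<Longrightarrow> integral_mat A \<longleftrightarrow> (\<forall>i<n. \<forall>j<n. A $$ (i, j) \<in> \<int>)"
  unfolding integral_mat_def by (fastforce simp: elements_mat_def)

lemma U_realD: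
  assumes "u \<in> U_real n"
  shows "u \<in> carrier_mat n n" "\<And>i j. j < i \<Longrightarrow> i < n \<Longrightarrow> u $$ (i, j) = 0"
    "\<And>i. i < n \<Longrightarrow> u $$ (i, i) = 1"
  using assms by (auto simp: U_real_def upper_triangular_def)

lemma U_real_mult:
  assumes a: "a \<in> U_real n" and b: "b \<in> U_real n"
  shows "a * b \<in> U_real n"
proof -
  note A = U_realD[OF a] and B = U_realD[OF b]
  have low: "(a * b) $$ (i, j) = 0" if "j < i" "i < n" for i j
  proof -
    have "a $$ (i, k) * b $$ (k, j) = 0" if "k < n" for k
      using A(2)[of k i] B(2)[of j k] \<open>j < i\<close> \<open>i < n\<close> that by (cases "k < i") auto
    then show ?thesis using that by (subst mult_entry[OF A(1) B(1)]) (auto intro!: sum.neutral)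
  qed
  have diag: "(a * b) $$ (i, i) = 1" if "i < n" for i
  proof -
    have "a $$ (i, k) * b $$ (k, i) = (if k = i then 1 else 0)" if "k < n" for k
      using A(2)[of k i] B(2)[of i k] A(3)[of i] B(3)[of i] \<open>i < n\<close> that
      by (cases k i rule: linorder_cases) auto
    then show ?thesis using that by (subst mult_entry[OF A(1) B(1)]) auto
  qed
  show ?thesis using low diag A(1) B(1) by (auto simp: U_real_def intro!: upper_triangularI)
qed

lemma U_real_mult_super:
  assumes a: "a \<in> U_real n" and b: "b \<in> U_real n" and i: "1 \<le> i" "i \<le> n - 1"
  shows "(a * b) $$ (i - 1, i) = a $$ (i - 1, i) + b $$ (i - 1, i)"
proof -
  note A = U_realD[OF a] and B = U_realD[OF b]
  have iN: "i - 1 < n" "i < n" using i by linarith+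
  have "a $$ (i - 1, k) * b $$ (k, i) =
      (if k = i - 1 then b $$ (i - 1, i) else 0) + (if k = i then a $$ (i - 1, i) else 0)"
    if "k < n" for k
    using A(2)[of k "i - 1"] B(2)[of i k] A(3)[of "i - 1"] B(3)[of i] i that
    by (cases "k < i - 1"; cases "k = i - 1"; cases "k = i") auto
  then have "(\<Sum>k<n. a $$ (i - 1, k) * b $$ (k, i)) =
      (\<Sum>k<n. (if k = i - 1 then b $$ (i - 1, i) else 0) + (if k = i then a $$ (i - 1, i) else 0))"
    by (intro sum.cong) auto
  also have "\<dots> = b $$ (i - 1, i) + a $$ (i - 1, i)"
    using iN by (simp add: sum.distrib)
  finally show ?thesis using iN by (subst mult_entry[OF A(1) B(1)]) auto
qed

lemma U_real_inverse:
  assumes a: "a \<in> U_real n"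
  shows "\<exists>b\<in>U_real n. a * b = 1\<^sub>m n \<and> b * a = 1\<^sub>m n"
proof -
  note A = U_realD[OF a]
  have "diag_mat a = replicate n 1"
    using A(1,3) by (intro nth_equalityI) (auto simp: diag_mat_def)
  then have "det a = 1"
    using a A(1) by (subst det_upper_triangular[of _ n]) (auto simp: U_real_def)
  then have "a \<in> Units (ring_mat TYPE(real) n undefined)"
    using A(1) by (intro det_non_zero_imp_unit) auto
  then obtain b where b: "b \<in> carrier_mat n n" "a * b = 1\<^sub>m n" "b * a = 1\<^sub>m n"
    by (auto simp: Units_def ring_mat_simps)
  have ent: "b $$ (i, j) = (if i = j then 1 else 0)" if "j \<le> i" "i < n" for i j
    using that
  proof (induction "n - i" arbitrary: i rule: less_induct)
    case less
    have "a $$ (i, k) * b $$ (k, j) = (if k = i then b $$ (i, j) else 0)" if "k < n" for k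
    proof (cases k i rule: linorder_cases)
      case greater
      then have "b $$ (k, j) = 0" using less.hyps[of k] less.prems that by auto
      with greater show ?thesis by auto
    qed (use A(2)[of k i] A(3)[of i] less.prems in auto)
    then have "(a * b) $$ (i, j) = b $$ (i, j)"
      using less.prems by (subst mult_entry[OF A(1) b(1)]) auto
    then show ?case using b(2) less.prems by auto
  qed
  then have "b \<in> U_real n" using b(1) by (auto simp: U_real_def intro!: upper_triangularI)
  with b show ?thesis by auto
qed

lemma D_ext_nonzero: "(\<And>i. 1 \<le> i \<Longrightarrow> i \<le> n - 1 \<Longrightarrow> D i > 0) \<Longrightarrow> D_ext n D k \<noteq> 0"
  unfolding D_ext_def by (metis less_numeral_extra(3) zero_neq_one)

lemma c_w0_carrier [simp]: "c_mat n D * w0 n \<in> carrier_mat n n"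
  by (auto simp: c_mat_def w0_def mat_diag_def)

lemma c_w0_entry:
  assumes "i < n" "j < n"
  shows "(c_mat n D * w0 n) $$ (i, j) = (if i + j = n - 1 then
    real (D_ext n D (n - i)) / real (D_ext n D (n - i - 1)) * (- 1) ^ j else 0)"
  using assms unfolding c_mat_def by (subst mat_diag_mult_left[of _ n n]) (auto simp: w0_def)

lemma U_real_antidiag_commute:
  assumes T: "T \<in> carrier_mat n n"
    and zero: "\<And>i j. i < n \<Longrightarrow> j < n \<Longrightarrow> i + j \<noteq> n - 1 \<Longrightarrow> T $$ (i, j) = 0"
    and nonzero: "\<And>i j. i < n \<Longrightarrow> j < n \<Longrightarrow> i + j = n - 1 \<Longrightarrow> T $$ (i, j) \<noteq> 0"
    and u: "u \<in> U_real n" and v: "v \<in> U_real n"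
    and eq: "u * T = T * v"
  shows "u = 1\<^sub>m n \<and> v = 1\<^sub>m n"
proof -
  note U = U_realD[OF u] and V = U_realD[OF v]
  have L: "(u * T) $$ (i, k) = u $$ (i, j) * T $$ (j, k)"
    if "i < n" "j < n" "k < n" "j + k = n - 1" for i j k
  proof -
    have "(u * T) $$ (i, k) = (\<Sum>l<n. u $$ (i, l) * T $$ (l, k))"
      using that by (intro mult_entry[OF U(1) T])
    also have "\<dots> = (\<Sum>l<n. if l = j then u $$ (i, j) * T $$ (j, k) else 0)"
    proof (intro sum.cong refl)
      fix l assume "l \<in> {..<n}"
      then show "u $$ (i, l) * T $$ (l, k) = (if l = j then u $$ (i, j) * T $$ (j, k) else 0)"
        using zero[of l k] that by (cases "l = j") simp_all
    qed
    finally show ?thesis using that by simp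
  qed
  have R: "(T * v) $$ (i, k) = T $$ (i, m) * v $$ (m, k)"
    if "i < n" "m < n" "k < n" "i + m = n - 1" for i m k
  proof -
    have "(T * v) $$ (i, k) = (\<Sum>l<n. T $$ (i, l) * v $$ (l, k))"
      using that by (intro mult_entry[OF T V(1)])
    also have "\<dots> = (\<Sum>l<n. if l = m then T $$ (i, m) * v $$ (m, k) else 0)"
    proof (intro sum.cong refl)
      fix l assume "l \<in> {..<n}"
      then show "T $$ (i, l) * v $$ (l, k) = (if l = m then T $$ (i, m) * v $$ (m, k) else 0)"
        using zero[of i l] that by (cases "l = m") simp_all
    qed
    finally show ?thesis using that by simp
  qed
  have u0: "u $$ (i, j) = 0" if ij: "i < j" "j < n" for i j
  proof -
    define k where "k = n - 1 - j"
    define m where "m = n - 1 - i"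
    have km: "k < n" "j + k = n - 1" "m < n" "i + m = n - 1" "k < m" "i < n"
      unfolding k_def m_def using ij by linarith+
    have "u $$ (i, j) * T $$ (j, k) = T $$ (i, m) * v $$ (m, k)"
      using L[of i j k] R[of i m k] km ij(2) eq by metis
    then show ?thesis
      using V(2)[OF km(5,3)] nonzero[OF ij(2) km(1,2)] by simp
  qed
  have "u $$ (i, j) = (if i = j then 1 else 0)" if "i < n" "j < n" for i j
    using U(2)[of j i] U(3)[of i] u0[of i j] that by (cases i j rule: linorder_cases) simp_all
  then have u1: "u = 1\<^sub>m n" using U(1) by (intro eq_matI) simp_all
  have "v $$ (m, k) = (if m = k then 1 else 0)" if mk: "m < n" "k < n" for m k
  proof -
    define i where "i = n - 1 - m"
    have i: "i < n" "i + m = n - 1" unfolding i_def using mk by linarith+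
    have "T $$ (i, k) = T $$ (i, m) * v $$ (m, k)"
      using R[OF i(1) mk i(2)] eq u1 left_mult_one_mat[OF T] by metis
    moreover have "T $$ (i, k) = 0" if "m \<noteq> k"
      using zero[OF i(1) mk(2)] i(2) that by linarith
    ultimately show ?thesis using nonzero[OF i(1) mk(1) i(2)] by (cases "m = k") simp_all
  qed
  then have "v = 1\<^sub>m n" using V(1) by (intro eq_matI) simp_all
  with u1 show ?thesis ..
qed

lemma U_real_c_w0_commute:
  assumes D: "\<And>i. 1 \<le> i \<Longrightarrow> i \<le> n - 1 \<Longrightarrow> D i > 0"
    and "u \<in> U_real n" "v \<in> U_real n" "u * (c_mat n D * w0 n) = (c_mat n D * w0 n) * v"
  shows "u = 1\<^sub>m n \<and> v = 1\<^sub>m n"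
proof (rule U_real_antidiag_commute[OF c_w0_carrier _ _ assms(2-4)])
  have nz: "D_ext n D k \<noteq> 0" for k using D_ext_nonzero[of n D k] D by blast
  fix i j assume ij: "i < n" "j < n"
  show "(c_mat n D * w0 n) $$ (i, j) = 0" if "i + j \<noteq> n - 1"
    unfolding c_w0_entry[OF ij] using that by (simp only: if_False)
  show "(c_mat n D * w0 n) $$ (i, j) \<noteq> 0" if "i + j = n - 1"
    unfolding c_w0_entry[OF ij] if_P[OF that] using nz by simp
qed

lemma bruhat_assoc:
  assumes "a \<in> U_real n" "b \<in> U_real n"
  shows "a * c_mat n D * w0 n * b = a * ((c_mat n D * w0 n) * b)"
proof -
  have "a \<in> carrier_mat n n" "b \<in> carrier_mat n n" "c_mat n D \<in> carrier_mat n n"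
    "w0 n \<in> carrier_mat n n"
    using assms by (auto simp: U_real_def c_mat_def w0_def)
  then show ?thesis by (simp add: assoc_mult_mat[of _ n n _ n _ n])
qed

lemma bruhat_unique:
  assumes D: "\<And>i. 1 \<le> i \<Longrightarrow> i \<le> n - 1 \<Longrightarrow> D i > 0"
    and a: "a \<in> U_real n" and b: "b \<in> U_real n" and a': "a' \<in> U_real n" and b': "b' \<in> U_real n"
    and eq: "a * c_mat n D * w0 n * b = a' * c_mat n D * w0 n * b'"
  shows "a = a' \<and> b = b'"
proof -
  let ?T = "c_mat n D * w0 n"
  obtain d where d: "d \<in> U_real n" "a' * d = 1\<^sub>m n" "d * a' = 1\<^sub>m n"
    using U_real_inverse[OF a'] by auto
  obtain f where f: "f \<in> U_real n" "b * f = 1\<^sub>m n" "f * b = 1\<^sub>m n"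
    using U_real_inverse[OF b] by auto
  note car = U_realD(1)[OF a] U_realD(1)[OF b] U_realD(1)[OF a'] U_realD(1)[OF b']
    U_realD(1)[OF d(1)] U_realD(1)[OF f(1)] c_w0_carrier[of n D]
  note assoc = assoc_mult_mat[of _ n n _ n _ n]
  have mc: "x * y \<in> carrier_mat n n" if "x \<in> carrier_mat n n" "y \<in> carrier_mat n n"
    for x y :: "real mat" using that by simp
  have eq1: "a * (?T * b) = a' * (?T * b')"
    using eq bruhat_assoc[OF a b, of D] bruhat_assoc[OF a' b', of D] by simp
  have "d * a * ?T = d * (a * (?T * b)) * f"
  proof -
    have "d * (a * (?T * b)) * f = d * (a * (?T * (b * f)))"
      using car by (simp add: assoc mc del: c_w0_carrier)
    also have "\<dots> = d * a * ?T" using car f(2)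
      by (simp add: assoc[of d a ?T] right_mult_one_mat[OF c_w0_carrier])
    finally show ?thesis by simp
  qed
  also have "\<dots> = d * (a' * (?T * b')) * f" using eq1 by simp
  also have "\<dots> = (d * a') * (?T * (b' * f))"
    using car by (simp add: assoc mc del: c_w0_carrier)
  also have "\<dots> = ?T * (b' * f)" using d(3)
    by (simp add: left_mult_one_mat[OF mc[OF c_w0_carrier mc[OF car(4) car(6)]]])
  finally have "d * a * ?T = ?T * (b' * f)" .
  from U_real_c_w0_commute[OF D U_real_mult[OF d(1) a] U_real_mult[OF b' f(1)] this]
  have da: "d * a = 1\<^sub>m n" and bf: "b' * f = 1\<^sub>m n" by simp_all
  have "a = (a' * d) * a" using d(2) car by simp
  also have "\<dots> = a' * (d * a)" using car by (simp add: assoc)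
  finally have aa: "a = a'" using da car by simp
  have "b' = b' * (f * b)" using f(3) car by simp
  also have "\<dots> = (b' * f) * b" using car by (simp add: assoc)
  finally have bb: "b = b'" using bf car by simp
  from aa bb show ?thesis ..
qed

lemma mu_eq:
  assumes D: "\<And>i. 1 \<le> i \<Longrightarrow> i \<le> n - 1 \<Longrightarrow> D i > 0"
    and b: "b1 \<in> U_real n" "b2 \<in> U_real n"
  shows "mu n D (b1 * c_mat n D * w0 n * b2) = b1"
    and "mu' n D (b1 * c_mat n D * w0 n * b2) = b2"
proof -
  show "mu n D (b1 * c_mat n D * w0 n * b2) = b1"
    unfolding mu_def using b bruhat_unique[where n = n and D = D, OF D] by (intro the_equality) blast+
  show "mu' n D (b1 * c_mat n D * w0 n * b2) = b2"
    unfolding mu'_def using b bruhat_unique[where n = n and D = D, OF D] by (intro the_equality) blast+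
qed

lemma psi_mult:
  assumes "u \<in> U_real n" "v \<in> U_real n"
  shows "psi n N (u * v) = psi n N u * psi n N v"
proof -
  have "(\<Sum>i = 1..n - 1. complex_of_int (N i) * of_real ((u * v) $$ (i - 1, i))) =
      (\<Sum>i = 1..n - 1. of_int (N i) * of_real (u $$ (i - 1, i)) +
        of_int (N i) * of_real (v $$ (i - 1, i)))"
    by (intro sum.cong refl, subst U_real_mult_super[OF assms]) (auto simp: distrib_left)
  then show ?thesis
    by (simp only: psi_def e_fun_def sum.distrib distrib_left exp_add)
qed

lemma e_fun_of_int: "e_fun (of_int k) = 1"
  using cis_multiple_2pi[of "of_int k"] by (simp add: e_fun_def cis_conv_exp mult_ac)

lemma psi_U_int:
  assumes "u \<in> U_int n"
  shows "psi n N u = 1"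
proof -
  have "u \<in> carrier_mat n n" "integral_mat u" using assms by (auto simp: U_int_def U_real_def)
  then have "(\<Sum>i = 1..n - 1. complex_of_int (N i) * of_real (u $$ (i - 1, i))) \<in> \<int>"
    by (intro Ints_sum Ints_mult) (auto simp: integral_mat_iff elim!: Ints_cases)
  then show ?thesis by (auto simp: psi_def e_fun_of_int elim!: Ints_cases)
qed

lemma mu_dcoset:
  assumes D: "\<And>i. 1 \<le> i \<Longrightarrow> i \<le> n - 1 \<Longrightarrow> D i > 0"
    and rel: "(\<gamma>, \<gamma>') \<in> dcoset_rel n D"
  obtains u v where "u \<in> U_int n" "v \<in> U_int n" "mu n D \<gamma> \<in> U_real n" "mu' n D \<gamma> \<in> U_real n"
    "mu n D \<gamma>' = u * mu n D \<gamma>" "mu' n D \<gamma>' = mu' n D \<gamma> * v"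
proof -
  let ?T = "c_mat n D * w0 n"
  from rel obtain u v b1 b2 where h: "u \<in> U_int n" "v \<in> U_int n" "b1 \<in> U_real n" "b2 \<in> U_real n"
    "\<gamma> = b1 * c_mat n D * w0 n * b2" "\<gamma>' = u * \<gamma> * v"
    by (auto simp: dcoset_rel_def C_set_def)
  have uv: "u \<in> U_real n" "v \<in> U_real n" using h by (auto simp: U_int_def)
  have car: "u \<in> carrier_mat n n" "v \<in> carrier_mat n n" "b1 \<in> carrier_mat n n" "b2 \<in> carrier_mat n n"
    "c_mat n D \<in> carrier_mat n n" "w0 n \<in> carrier_mat n n"
    using uv h U_realD(1) by (auto simp: c_mat_def w0_def)
  have mc: "x * y \<in> carrier_mat n n" if "x \<in> carrier_mat n n" "y \<in> carrier_mat n n"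
    for x y :: "real mat" using that by simp
  have "\<gamma>' = (u * b1) * c_mat n D * w0 n * (b2 * v)"
    using car unfolding h(5,6) by (simp add: assoc_mult_mat[of _ n n _ n _ n] mc)
  with mu_eq[OF D U_real_mult[OF uv(1) h(3)] U_real_mult[OF h(4) uv(2)]]
  have "mu n D \<gamma>' = u * b1" "mu' n D \<gamma>' = b2 * v" by auto
  moreover have "mu n D \<gamma> = b1" "mu' n D \<gamma> = b2" using mu_eq[OF D h(3,4)] h(5) by auto
  ultimately show ?thesis using that[of u v] h by auto
qed

lemma one_U_int: "1\<^sub>m n \<in> U_int n"
  by (auto simp: U_int_def U_real_def integral_mat_iff[OF one_carrier_mat])

lemma dcoset_rel_refl: "\<gamma> \<in> C_set n D \<Longrightarrow> (\<gamma>, \<gamma>) \<in> dcoset_rel n D"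
proof -
  assume g: "\<gamma> \<in> C_set n D"
  then have "\<gamma> \<in> carrier_mat n n" by (auto simp: C_set_def SL_int_def)
  then have "\<gamma> = 1\<^sub>m n * \<gamma> * 1\<^sub>m n" by simp
  with g one_U_int show ?thesis unfolding dcoset_rel_def by blast
qed

lemma image_psi_mu_mu':
  assumes D: "\<And>i. 1 \<le> i \<Longrightarrow> i \<le> n - 1 \<Longrightarrow> D i > 0"
    and x: "x \<in> X_set n D"
  obtains \<gamma> where "\<gamma> \<in> x" "\<gamma> \<in> C_set n D"
    "(\<lambda>\<gamma>. psi n N (mu n D \<gamma>)) ` x = {psi n N (mu n D \<gamma>)}"
    "(\<lambda>\<gamma>. psi n N' (mu' n D \<gamma>)) ` x = {psi n N' (mu' n D \<gamma>)}"
proof -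
  from x obtain \<gamma> where g: "\<gamma> \<in> C_set n D" "x = dcoset_rel n D `` {\<gamma>}"
    by (auto simp: X_set_def quotient_def)
  have mem: "\<gamma> \<in> x" using dcoset_rel_refl[OF g(1)] g(2) by auto
  have "psi n N (mu n D \<gamma>') = psi n N (mu n D \<gamma>) \<and> psi n N' (mu' n D \<gamma>') = psi n N' (mu' n D \<gamma>)"
    if "\<gamma>' \<in> x" for \<gamma>'
  proof -
    have "(\<gamma>, \<gamma>') \<in> dcoset_rel n D" using that g by auto
    from mu_dcoset[OF D this] obtain u v where "u \<in> U_int n" "v \<in> U_int n"
      "mu n D \<gamma> \<in> U_real n" "mu' n D \<gamma> \<in> U_real n"
      "mu n D \<gamma>' = u * mu n D \<gamma>" "mu' n D \<gamma>' = mu' n D \<gamma> * v" by blast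
    moreover from this have "u \<in> U_real n" "v \<in> U_real n" by (auto simp: U_int_def)
    ultimately show ?thesis by (simp add: psi_mult psi_U_int)
  qed
  note const = this
  show ?thesis
  proof (rule that[OF mem g(1)])
    show "(\<lambda>\<gamma>. psi n N (mu n D \<gamma>)) ` x = {psi n N (mu n D \<gamma>)}"
      using mem const by (intro subset_antisym image_subsetI) blast+
    show "(\<lambda>\<gamma>. psi n N' (mu' n D \<gamma>)) ` x = {psi n N' (mu' n D \<gamma>)}"
      using mem const by (intro subset_antisym image_subsetI) blast+
  qed
qed

end

(* Reversing the rows of an integral matrix b1 c w0 b2 turns its Bruhat decomposition into an
   LDU factorisation with U = b2 and L = b1 with both index orders reversed, whose leading
   principal minors are the D_k up to sign.  Replacing the last column of the k-th leading block
   by the next one multiplies its minor by the superdiagonal entry of U in row k.  The new minor is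
   an integer, so D_k clears the denominator of that entry, and changing N_k by a multiple of D_k
   leaves every single term of the Kloosterman sum unchanged.  The transposed argument treats L,
   hence M. *)
theory Submission
  imports Defs
begin

lemma det_Ints:
  fixes A :: "'a :: comm_ring_1 mat"
  assumes "A \<in> carrier_mat n n" "\<And>i j. i < n \<Longrightarrow> j < n \<Longrightarrow> A $$ (i, j) \<in> \<int>"
  shows "det A \<in> \<int>"
proof -
  have "(\<Prod>i = 0..<n. A $$ (i, p i)) \<in> \<int>" if "p permutes {0..<n}" for p
    using assms(2) permutes_in_image[OF that] by (intro Ints_prod) auto
  then show ?thesis
    unfolding det_def'[OF assms(1)] by (auto intro!: Ints_sum Ints_mult simp: sign_def)
qed

text \<open>Take rows \<open>0..m\<close> of the integral product \<open>L d R\<close> and columns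
  \<open>0..m-1\<close> and \<open>m+1\<close>. As \<open>L\<close> is lower triangular, this block
  factors as a unipotent matrix times an upper triangular one, whose determinant is the stated
  product; so that product is an integer minor. Index functions instead of matrices make it easy to
  reverse or transpose the factors.\<close>

lemma LDU_superdiagonal_Ints:
  fixes L R :: "nat \<Rightarrow> nat \<Rightarrow> 'a :: idom" and d :: "nat \<Rightarrow> 'a"
  assumes L0: "\<And>i l. i < l \<Longrightarrow> l < n \<Longrightarrow> L i l = 0" and L1: "\<And>i. i < n \<Longrightarrow> L i i = 1"
    and R0: "\<And>l j. j < l \<Longrightarrow> l < n \<Longrightarrow> R l j = 0" and R1: "\<And>l. l < n \<Longrightarrow> R l l = 1"
    and int: "\<And>i j. i < n \<Longrightarrow> j < n \<Longrightarrow> (\<Sum>l<n. L i l * d l * R l j) \<in> \<int>"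
    and m: "Suc m < n"
  shows "(\<Prod>l<Suc m. d l) * R m (Suc m) \<in> \<int>"
proof -
  \<comment> \<open>\<open>J\<close> keeps the columns before \<open>m\<close> and replaces column
    \<open>m\<close> by its successor.\<close>
  define J where "J j = (if j = m then Suc m else j)" for j
  define A where "A = mat (Suc m) (Suc m) (\<lambda>(i, l). L i l)"
  define B where "B = mat (Suc m) (Suc m) (\<lambda>(l, j). d l * R l (J j))"
  have A: "A \<in> carrier_mat (Suc m) (Suc m)" and B: "B \<in> carrier_mat (Suc m) (Suc m)"
    by (auto simp: A_def B_def)
  have "(A * B) $$ (i, j) = (\<Sum>l<n. L i l * d l * R l (J j))" if "i < Suc m" "j < Suc m" for i j
  proof -
    have "(A * B) $$ (i, j) = (\<Sum>l<Suc m. L i l * d l * R l (J j))"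
      using that by (simp add: A_def B_def scalar_prod_def lessThan_atLeast0 mult.assoc
          del: sum.op_ivl_Suc)
    \<comment> \<open>The added terms have \<open>i \<le> m < l\<close>, where \<open>L i l\<close>
      vanishes.\<close>
    also have "\<dots> = (\<Sum>l<n. L i l * d l * R l (J j))"
      using m that by (intro sum.mono_neutral_left) (auto intro!: L0)
    finally show ?thesis .
  qed
  then have "det (A * B) \<in> \<int>"
    using int m A B by (intro det_Ints[of _ "Suc m"]) (auto simp: J_def)
  moreover have "det A = 1"
  proof -
    have "diag_mat A = replicate (Suc m) 1"
      using m L1 by (intro nth_equalityI) (auto simp: A_def diag_mat_def simp del: upt_Suc replicate_Suc)
    then show ?thesis
      using m L0 by (subst det_lower_triangular[OF _ A]) (auto simp: A_def)
  qed
  moreover have "det B = (\<Prod>l<Suc m. d l) * R m (Suc m)"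
  proof -
    \<comment> \<open>The shifted column is the last one of the block, with nothing below its
      diagonal entry \<open>d m * R m (Suc m)\<close>.\<close>
    have "upper_triangular B"
      using m R0 by (auto simp: B_def J_def)
    then have "det B = (\<Prod>l<Suc m. B $$ (l, l))"
      using B by (simp add: det_upper_triangular[OF _ B] prod_list_diag_prod lessThan_atLeast0
          del: prod.op_ivl_Suc)
    also have "\<dots> = (\<Prod>l<m. d l) * (d m * R m (Suc m))"
      using m R1 by (auto simp: B_def J_def intro!: prod.cong)
    finally show ?thesis by (simp add: mult.assoc)
  qed
  ultimately show ?thesis by (simp add: det_mult[OF A B])
qed

text \<open>Up to sign the entry in column \<open>l\<close> is D_{l+1}/D_l, so the product
  telescopes down to D_0 = 1.\<close>

lemma c_w0_antidiagonal_prod: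
  assumes D: "\<And>i. 1 \<le> i \<Longrightarrow> i \<le> n - 1 \<Longrightarrow> D i > 0" and "k \<le> n"
  shows "(\<Prod>l<k. (c_mat n D * w0 n) $$ (n - Suc l, l)) = real (D_ext n D k) * (\<Prod>l<k. (- 1) ^ l)"
  using \<open>k \<le> n\<close>
proof (induction k)
  case 0
  then show ?case by (simp add: D_ext_def)
next
  case (Suc k)
  have "n - (n - Suc k) = Suc k" "n - (n - Suc k) - 1 = k" "n - Suc k + k = n - 1"
    using Suc.prems by auto
  then show ?case
    using Suc D_ext_nonzero[of n D k, OF D] by (simp add: c_w0_entry del: index_mult_mat)
qed

text \<open>Reversing the rows of the integral matrix gives the factorisation \<open>L d R\<close>,
  in which \<open>d\<close> is the antidiagonal read upwards from the bottom left corner. Reversing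
  both indices of \<open>b1\<close> is what pairs \<open>D k\<close> with its superdiagonal entry
  number \<open>n - k\<close>.\<close>

lemma bruhat_integral_superdiagonal:
  assumes D: "\<And>i. 1 \<le> i \<Longrightarrow> i \<le> n - 1 \<Longrightarrow> D i > 0"
    and b: "b1 \<in> U_real n" "b2 \<in> U_real n"
    and int: "integral_mat (b1 * c_mat n D * w0 n * b2)"
    and k: "1 \<le> k" "k \<le> n - 1"
  shows "real (D k) * b2 $$ (k - 1, k) \<in> \<int>"
    and "real (D k) * b1 $$ (n - k - 1, n - k) \<in> \<int>"
proof -
  let ?T = "c_mat n D * w0 n"
  define d where "d l = ?T $$ (n - Suc l, l)" for l
  define L where "L i l = b1 $$ (n - Suc i, n - Suc l)" for i l
  define R where "R l j = b2 $$ (l, j)" for l j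
  note B1 = U_realD[OF b(1)] and B2 = U_realD[OF b(2)]
  have ent: "(b1 * c_mat n D * w0 n * b2) $$ (n - Suc i, j) = (\<Sum>l<n. L i l * d l * R l j)"
    if "i < n" "j < n" for i j
  proof -
    have Tb: "(?T * b2) $$ (n - Suc l, j) = d l * R l j" if "l < n" for l
    proof -
      have "(?T * b2) $$ (n - Suc l, j) = (\<Sum>r<n. ?T $$ (n - Suc l, r) * b2 $$ (r, j))"
        using that \<open>j < n\<close> by (intro mult_entry B2(1) c_w0_carrier) auto
      also have "\<dots> = (\<Sum>r<n. if r = l then d l * R l j else 0)"
        using that by (intro sum.cong) (auto simp: c_w0_entry d_def R_def simp del: index_mult_mat)
      finally show ?thesis using that by simp
    qed
    have "(b1 * c_mat n D * w0 n * b2) $$ (n - Suc i, j) =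
        (\<Sum>l<n. b1 $$ (n - Suc i, l) * (?T * b2) $$ (l, j))"
      unfolding bruhat_assoc[OF b]
      using that B2(1) by (intro mult_entry B1(1) mult_carrier_mat[OF c_w0_carrier]) auto
    also have "\<dots> = (\<Sum>l<n. L i l * d l * R l j)"
      \<comment> \<open>The inner index is reversed along with the rows, so that \<open>b1\<close>
        turns into the lower triangular \<open>L\<close>.\<close>
      using that by (subst sum.nat_diff_reindex[symmetric])
        (auto simp: Tb L_def mult.assoc simp del: index_mult_mat intro!: sum.cong)
    finally show ?thesis .
  qed
  have car: "b1 * c_mat n D * w0 n * b2 \<in> carrier_mat n n"
    unfolding bruhat_assoc[OF b] by (intro mult_carrier_mat[OF B1(1)] mult_carrier_mat[OF _ B2(1)] c_w0_carrier)
  have Z: "(\<Sum>l<n. L i l * d l * R l j) \<in> \<int>" if "i < n" "j < n" for i j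
    unfolding ent[OF that, symmetric] using int that by (simp add: integral_mat_iff[OF car])
  have L: "L i l = 0" if "i < l" "l < n" for i l
    using that B1(2) by (simp add: L_def)
  have R: "R l j = 0" if "j < l" "l < n" for l j
    using that B2(2) by (simp add: R_def)
  have diag: "L i i = 1" "R i i = 1" if "i < n" for i
    using that B1(3) B2(3) by (auto simp: L_def R_def)
  obtain m where m: "k = Suc m" "Suc m < n" using k by (cases k) auto
  have "(\<Prod>l<k. d l) * R m k \<in> \<int>"
    unfolding m(1) by (rule LDU_superdiagonal_Ints[where L = L and n = n]) (use L R diag Z m in auto)
  moreover have "(\<Prod>l<k. d l) * L k m \<in> \<int>"
    unfolding m(1)
  \<comment> \<open>The transposed product is integral too; in it the transpose of \<open>R\<close>
    is the lower factor and that of \<open>L\<close> the upper one.\<close>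
  proof (rule LDU_superdiagonal_Ints[where L = "\<lambda>i l. R l i" and R = "\<lambda>l j. L j l" and n = n])
    show "(\<Sum>l<n. R l i * d l * L j l) \<in> \<int>" if "i < n" "j < n" for i j
      using Z[OF that(2,1)] by (simp add: mult_ac)
  qed (use L R diag m in auto)
  moreover have "(\<Prod>l<k. d l) = real (D k) * (\<Prod>l<k. (- 1) ^ l)"
    using c_w0_antidiagonal_prod[of n D k] D k by (simp add: d_def D_ext_def del: index_mult_mat)
  moreover have "real (D k) * x \<in> \<int>" if "real (D k) * (\<Prod>l<k. (- 1) ^ l) * x \<in> \<int>" for x
  proof -
    \<comment> \<open>The sign \<open>s\<close> is its own inverse, so multiplying by it once more
      removes it and preserves integrality.\<close>
    define s where "s = (\<Prod>l<k. (- 1 :: real) ^ l)"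
    have "s * s = 1"
      unfolding s_def by (simp flip: prod.distrib power_mult_distrib)
    then have "real (D k) * x = real (D k) * x * (s * s)"
      by (simp only: mult_1_right)
    also have "\<dots> = (real (D k) * s * x) * s"
      by (simp only: mult_ac)
    also have "\<dots> \<in> \<int>"
      unfolding s_def by (intro Ints_mult[OF that] Ints_prod Ints_power) auto
    finally show ?thesis .
  qed
  ultimately show "real (D k) * b2 $$ (k - 1, k) \<in> \<int>"
    and "real (D k) * b1 $$ (n - k - 1, n - k) \<in> \<int>"
    using m by (auto simp: R_def L_def)
qed

text \<open>Each summand of the exponent changes by an integer multiple of
  \<open>E i * u $$ (i - 1, i)\<close>, hence by an integer, and \<open>e_fun\<close> has period 1.
  The moduli \<open>E\<close> are kept general because they occur both in the order of
  \<open>D\<close> and reversed.\<close>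

lemma psi_cong_mod:
  assumes N: "\<And>i. 1 \<le> i \<Longrightarrow> i \<le> n - 1 \<Longrightarrow> [N i = N' i] (mod int (E i))"
    and E: "\<And>i. 1 \<le> i \<Longrightarrow> i \<le> n - 1 \<Longrightarrow> real (E i) * u $$ (i - 1, i) \<in> \<int>"
  shows "psi n N u = psi n N' u"
proof -
  let ?s = "\<lambda>N. \<Sum>i = 1..n - 1. complex_of_int (N i) * of_real (u $$ (i - 1, i))"
  have "complex_of_int (N i) * of_real (u $$ (i - 1, i)) -
      of_int (N' i) * of_real (u $$ (i - 1, i)) \<in> \<int>" if i: "i \<in> {1..n - 1}" for i
  proof -
    obtain q where q: "N i - N' i = int (E i) * q"
      using N[of i] i by (auto simp: cong_iff_dvd_diff dvd_def)
    obtain z where z: "real (E i) * u $$ (i - 1, i) = of_int z"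
      using E[of i] i by (auto elim: Ints_cases)
    have "complex_of_int (N i - N' i) * of_real (u $$ (i - 1, i)) =
        of_int q * of_real (real (E i) * u $$ (i - 1, i))"
      unfolding q by (simp add: mult_ac)
    then show ?thesis unfolding z by (simp add: left_diff_distrib)
  qed
  then have "?s N - ?s N' \<in> \<int>"
    unfolding sum_subtractf[symmetric] by (intro Ints_sum)
  then obtain z where "?s N - ?s N' = of_int z"
    by (rule Ints_cases)
  then have "?s N = ?s N' + of_int z"
    by (simp only: diff_eq_eq add.commute)
  then have "psi n N u = psi n N' u * e_fun (of_int z)"
    by (simp only: psi_def e_fun_def distrib_left exp_add)
  then show ?thesis by (simp add: e_fun_of_int)
qed

theorem proposition3p1:
  fixes n :: nat and D :: "nat \<Rightarrow> nat" and M M' N N' :: "nat \<Rightarrow> int"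
  assumes "n \<ge> 2"
    and "\<And>i. 1 \<le> i \<Longrightarrow> i \<le> n - 1 \<Longrightarrow> D i > 0"
    and "\<And>i. 1 \<le> i \<Longrightarrow> i \<le> n - 1 \<Longrightarrow> [M i = M' i] (mod int (D i))"
    and "\<And>i. 1 \<le> i \<Longrightarrow> i \<le> n - 1 \<Longrightarrow> [N i = N' i] (mod int (D i))"
  shows "kloosterman n M N D = kloosterman n M' N' D"
proof -
  have eq: "psi n (tilde n M) (mu n D \<gamma>) = psi n (tilde n M') (mu n D \<gamma>)"
    "psi n N (mu' n D \<gamma>) = psi n N' (mu' n D \<gamma>)" if \<gamma>_mem: "\<gamma> \<in> C_set n D" for \<gamma>
  proof -
    obtain b1 b2 where b: "b1 \<in> U_real n" "b2 \<in> U_real n"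
      and \<gamma>: "\<gamma> = b1 * c_mat n D * w0 n * b2" and int: "integral_mat \<gamma>"
      using \<gamma>_mem by (auto simp only: C_set_def SL_int_def)
    note Z = bruhat_integral_superdiagonal[OF assms(2) b int[unfolded \<gamma>]]
    have "psi n (tilde n M) b1 = psi n (tilde n M') b1"
    \<comment> \<open>\<open>tilde\<close> puts M_{n-i} in place \<open>i\<close>, and D_{n-i} is
      also what clears the superdiagonal entry number \<open>i\<close> of \<open>b1\<close>.\<close>
    proof (rule psi_cong_mod[where E = "\<lambda>i. D (n - i)"])
      fix i assume i: "1 \<le> i" "i \<le> n - 1"
      then show "[tilde n M i = tilde n M' i] (mod int (D (n - i)))"
        unfolding tilde_def by (intro assms(3)) auto
      have "n - (n - i) = i" using i by simp
      then show "real (D (n - i)) * b1 $$ (i - 1, i) \<in> \<int>"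
        using Z(2)[of "n - i"] i by simp
    qed
    moreover have "psi n N b2 = psi n N' b2"
      by (rule psi_cong_mod[OF assms(4) Z(1)])
    moreover have "mu n D \<gamma> = b1" "mu' n D \<gamma> = b2"
      unfolding \<gamma> using mu_eq[OF assms(2) b] by auto
    ultimately show "psi n (tilde n M) (mu n D \<gamma>) = psi n (tilde n M') (mu n D \<gamma>)"
      "psi n N (mu' n D \<gamma>) = psi n N' (mu' n D \<gamma>)" by auto
  qed
  show ?thesis
    unfolding kloosterman_def
  proof (intro sum.cong refl)
    fix x assume "x \<in> X_set n D"
    \<comment> \<open>Since \<open>eq\<close> holds at every element of the double coset, the image
      sets agree before \<open>the_elem\<close> is applied.\<close>
    then have "x \<subseteq> C_set n D"
      by (auto simp: X_set_def quotient_def dcoset_rel_def)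
    with eq have "(\<lambda>\<gamma>. psi n (tilde n M) (mu n D \<gamma>)) ` x = (\<lambda>\<gamma>. psi n (tilde n M') (mu n D \<gamma>)) ` x"
      "(\<lambda>\<gamma>. psi n N (mu' n D \<gamma>)) ` x = (\<lambda>\<gamma>. psi n N' (mu' n D \<gamma>)) ` x"
      by (auto intro!: image_cong)
    then show "the_elem ((\<lambda>\<gamma>. psi n (tilde n M) (mu n D \<gamma>)) ` x) *
        the_elem ((\<lambda>\<gamma>. psi n N (mu' n D \<gamma>)) ` x) =
      the_elem ((\<lambda>\<gamma>. psi n (tilde n M') (mu n D \<gamma>)) ` x) *
        the_elem ((\<lambda>\<gamma>. psi n N' (mu' n D \<gamma>)) ` x)" by simp
  qed
qed

end
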